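(* Let $\lambda>1$ be a natural number and let $\Omega=\{(x,y,z)\in\mathbb{R}^3 : y\neq 0\}$. For every matrix $\begin{bmatrix} a & b\\ c & d\end{bmatrix}\in SL(2,\mathbb{R})$ define the smooth functions on $\Omega$ $$C_{a,b}(x,y,z):=\tfrac{a}{2}(x^2+y^2+z^2)+b\,xy^{\lambda},\qquad H_{c,d}(x,y,z):=\tfrac{c}{2}(x^2+y^2+z^2)+d\,xy^{\lambda},\qquad \nu(x,y,z):=y^{1-\lambda},$$ and the bracket $\{f,g\}_{a,b}:=\langle\nabla C_{a,b},\nabla f\times\nabla g\rangle$ for $f,g\in C^\infty(\Omega,\mathbb{R})$. Then $(\Omega,\nu\{\cdot,\cdot\}_{a,b},H_{c,d})$ is a Hamilton--Poisson realization of the rattleback system $$\dot x=\lambda xz,\qquad \dot y=-yz,\qquad \dot z=y^2-\lambda x^2$$ (restricted to $\Omega$). Thus the rattleback system admits a family of Hamilton--Poisson realizations parameterized by $SL(2,\mathbb{R})$.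
   Context: $\langle\cdot,\cdot\rangle$ is the canonical inner product on $\mathbb{R}^3$ and $\nabla$ the corresponding gradient. For a smooth function $C$ on an open set $\Omega\subseteq\mathbb{R}^3$, the bracket $\{f,g\}_C=\langle\nabla C,\nabla f\times\nabla g\rangle$ is a Poisson bracket on $\Omega$, and for any nonvanishing smooth $\nu$, $\nu\{\cdot,\cdot\}_C$ is again a Poisson bracket. Its matrix is $\nu\Pi_C$ with $\Pi_C=[\{\pi_i,\pi_j\}_C]_{1\le i,j\le 3}$, where $\pi_1,\pi_2,\pi_3$ are the coordinate functions. The Hamiltonian vector field of $H\in C^\infty(\Omega,\mathbb{R})$ is $X_H=\nu\Pi_C\nabla H$, equivalently its Lie derivative acts on functions by $f\mapsto\nu\{f,H\}_C$. The triple $(\Omega,\nu\{\cdot,\cdot\}_C,H)$ is a Hamilton--Poisson realization of a system of differential equations $\dot u=X(u)$ on $\Omega$ if $\nu\{\cdot,\cdot\}_C$ is a Poisson bracket on $\Omega$ and $X=X_H$. *)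

theory Defs
  imports "HOL-Analysis.Analysis"
begin

text \<open>Functions on an open set \<open>\<Omega>\<close> are represented by total functions whose values
  outside \<open>\<Omega>\<close> are irrelevant. The definitions below are intended for open sets.\<close>

primrec Ck_on :: "nat \<Rightarrow> 'a::euclidean_space set \<Rightarrow> ('a \<Rightarrow> real) \<Rightarrow> bool" where
  "Ck_on 0 \<Omega> f \<longleftrightarrow> continuous_on \<Omega> f"
| "Ck_on (Suc k) \<Omega> f \<longleftrightarrow>
     (\<forall>x\<in>\<Omega>. f differentiable (at x)) \<and>
     (\<forall>v. Ck_on k \<Omega> (\<lambda>x. frechet_derivative f (at x) v))"

definition smooth_on :: "'a::euclidean_space set \<Rightarrow> ('a \<Rightarrow> real) \<Rightarrow> bool" where
  "smooth_on \<Omega> f \<longleftrightarrow> (\<forall>k. Ck_on k \<Omega> f)"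

definition grad :: "('a::real_inner \<Rightarrow> real) \<Rightarrow> 'a \<Rightarrow> 'a" where
  "grad f x = (THE D. GDERIV f x :> D)"

type_synonym 'a bracket = "('a \<Rightarrow> real) \<Rightarrow> ('a \<Rightarrow> real) \<Rightarrow> 'a \<Rightarrow> real"

text \<open>A Poisson bracket on the open set \<open>\<Omega>\<close>: a Lie bracket on the real vector space of smooth
  functions on \<open>\<Omega>\<close> that is a derivation in its arguments. The second conjunct expresses that
  the bracket is an operation on functions on \<open>\<Omega>\<close>, i.e. that it does not depend on the values
  of the representing total functions outside \<open>\<Omega>\<close>. Linearity and the Leibniz rule in the second
  argument follow by skew-symmetry.\<close>

definition poisson_bracket_on :: "'a::euclidean_space set \<Rightarrow> 'a bracket \<Rightarrow> bool" where
  "poisson_bracket_on \<Omega> B \<longleftrightarrow>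
     (\<forall>f g. smooth_on \<Omega> f \<longrightarrow> smooth_on \<Omega> g \<longrightarrow> smooth_on \<Omega> (B f g)) \<and>
     (\<forall>f f' g g'. smooth_on \<Omega> f \<longrightarrow> smooth_on \<Omega> f' \<longrightarrow> smooth_on \<Omega> g \<longrightarrow> smooth_on \<Omega> g' \<longrightarrow>
        (\<forall>x\<in>\<Omega>. f x = f' x) \<longrightarrow> (\<forall>x\<in>\<Omega>. g x = g' x) \<longrightarrow> (\<forall>x\<in>\<Omega>. B f g x = B f' g' x)) \<and>
     (\<forall>f g. smooth_on \<Omega> f \<longrightarrow> smooth_on \<Omega> g \<longrightarrow> (\<forall>x\<in>\<Omega>. B f g x = - B g f x)) \<and>
     (\<forall>f g h p q. smooth_on \<Omega> f \<longrightarrow> smooth_on \<Omega> g \<longrightarrow> smooth_on \<Omega> h \<longrightarrow>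
        (\<forall>x\<in>\<Omega>. B (\<lambda>u. p * f u + q * g u) h x = p * B f h x + q * B g h x)) \<and>
     (\<forall>f g h. smooth_on \<Omega> f \<longrightarrow> smooth_on \<Omega> g \<longrightarrow> smooth_on \<Omega> h \<longrightarrow>
        (\<forall>x\<in>\<Omega>. B (\<lambda>u. f u * g u) h x = f x * B g h x + g x * B f h x)) \<and>
     (\<forall>f g h. smooth_on \<Omega> f \<longrightarrow> smooth_on \<Omega> g \<longrightarrow> smooth_on \<Omega> h \<longrightarrow>
        (\<forall>x\<in>\<Omega>. B f (B g h) x + B g (B h f) x + B h (B f g) x = 0))"

definition bracket_of :: "(real^3 \<Rightarrow> real) \<Rightarrow> (real^3) bracket" where
  "bracket_of C f g x = grad C x \<bullet> cross3 (grad f x) (grad g x)"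

definition scaled_bracket :: "('a \<Rightarrow> real) \<Rightarrow> 'a bracket \<Rightarrow> 'a bracket" where
  "scaled_bracket \<nu> B f g x = \<nu> x * B f g x"

definition bracket_matrix :: "(real^'n) bracket \<Rightarrow> real^'n \<Rightarrow> real^'n^'n" where
  "bracket_matrix B x = (\<chi> i j. B (\<lambda>u. u $ i) (\<lambda>u. u $ j) x)"

definition hamiltonian_field :: "(real^'n) bracket \<Rightarrow> (real^'n \<Rightarrow> real) \<Rightarrow> real^'n \<Rightarrow> real^'n" where
  "hamiltonian_field B H x = bracket_matrix B x *v grad H x"

text \<open>The system \<open>u' = X(u)\<close> is represented by its vector field \<open>X\<close>, restricted to \<open>\<Omega>\<close>.\<close>

definition hamilton_poisson_realization ::
  "(real^'n) set \<Rightarrow> (real^'n) bracket \<Rightarrow> (real^'n \<Rightarrow> real) \<Rightarrow> (real^'n \<Rightarrow> real^'n) \<Rightarrow> bool" where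
  "hamilton_poisson_realization \<Omega> B H X \<longleftrightarrow>
     open \<Omega> \<and> poisson_bracket_on \<Omega> B \<and> smooth_on \<Omega> H \<and>
     (\<forall>u\<in>\<Omega>. X u = hamiltonian_field B H u)"

definition SL2 :: "(real^2^2) set" where
  "SL2 = {A. det A = 1}"

text \<open>Coordinates: \<open>x = u $ 1\<close>, \<open>y = u $ 2\<close>, \<open>z = u $ 3\<close>.\<close>

definition rattleback_domain :: "(real^3) set" where
  "rattleback_domain = {u. u $ 2 \<noteq> 0}"

definition rattleback_field :: "nat \<Rightarrow> real^3 \<Rightarrow> real^3" where
  "rattleback_field l u =
     vector [real l * u $ 1 * u $ 3, - (u $ 2 * u $ 3), (u $ 2)^2 - real l * (u $ 1)^2]"

text \<open>Both \<open>C\<^sub>a\<^sub>b\<close> and \<open>H\<^sub>c\<^sub>d\<close> are members of this two-parameter family.\<close>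

definition rattleback_function :: "nat \<Rightarrow> real \<Rightarrow> real \<Rightarrow> real^3 \<Rightarrow> real" where
  "rattleback_function l p q u =
     p / 2 * ((u $ 1)^2 + (u $ 2)^2 + (u $ 3)^2) + q * (u $ 1 * (u $ 2)^l)"

definition rattleback_factor :: "nat \<Rightarrow> real^3 \<Rightarrow> real" where
  "rattleback_factor l u = (u $ 2) powi (1 - int l)"

end

theory Submission
  imports Defs
begin

text \<open>
  Write \<open>s\<close> for half the squared norm and \<open>t\<close> for \<open>x y\<^sup>\<lambda>\<close>, so that \<open>C = a s + b t\<close> and
  \<open>H = c s + d t\<close>. The Hamiltonian field has components \<open>\<nu> {\<pi>\<^sub>i, H}\<close>, that is, it is
  \<open>\<nu> (\<nabla>H \<times> \<nabla>C) = - (a d - b c) \<nu> (\<nabla>s \<times> \<nabla>t)\<close>. The cross product is bilinear and alternating, hence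
  the realization depends on the matrix through its determinant only. The vector
  \<open>- (\<nabla>s \<times> \<nabla>t)\<close> is \<open>y\<^sup>\<lambda>\<^sup>-\<^sup>1\<close> times the rattleback field, and \<open>\<nu>\<close> cancels this power
  (\<open>rattleback_field_hamiltonian\<close>).

  The larger part of the proof is that \<open>\<nu> {\<cdot>, \<cdot>}\<^sub>C\<close> is a Poisson bracket, for arbitrary smooth
  \<open>\<nu>\<close> and \<open>C\<close> on an open set (\<open>poisson_scaled_bracket\<close>). The bracket has the form
  \<open>{f, g} = w \<bullet> (\<nabla>f \<times> \<nabla>g)\<close> with the vector field \<open>w = \<nu> \<nabla>C\<close>. Everything except the Jacobi
  identity is the product rule. In the cyclic sum of \<open>{f, {g, h}}\<close> the second derivatives of
  \<open>f\<close>, \<open>g\<close>, \<open>h\<close> cancel because Hessians are symmetric, and what remains is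
  \<open>- (w \<bullet> curl w) det (\<nabla>f, \<nabla>g, \<nabla>h)\<close> (\<open>cross_bracket_jacobi\<close>). For \<open>w = \<nu> \<nabla>C\<close> the curl is
  \<open>\<nabla>\<nu> \<times> \<nabla>C\<close>, which is orthogonal to \<open>w\<close>, so the Jacobi identity holds.

  The analysis behind this is that smooth functions are closed under ring operations, inverses and
  differentiation, and that second derivatives commute (\<open>dir_deriv_commute\<close>).
\<close>

section \<open>Directional derivatives\<close>

abbreviation dir_deriv :: "'a::real_normed_vector \<Rightarrow> ('a \<Rightarrow> real) \<Rightarrow> 'a \<Rightarrow> real" where
  "dir_deriv v f \<equiv> (\<lambda>x. frechet_derivative f (at x) v)"

lemma dir_deriv_eqI: "(f has_derivative f') (at x) \<Longrightarrow> dir_deriv v f x = f' v"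
  by (metis frechet_derivative_at)

lemma dir_deriv_add:
  assumes "f differentiable (at x)" "g differentiable (at x)"
  shows "dir_deriv v (\<lambda>x. f x + g x) x = dir_deriv v f x + dir_deriv v g x"
  using assms by (intro dir_deriv_eqI has_derivative_add) (simp_all add: frechet_derivative_works)

lemma dir_deriv_diff:
  assumes "f differentiable (at x)" "g differentiable (at x)"
  shows "dir_deriv v (\<lambda>x. f x - g x) x = dir_deriv v f x - dir_deriv v g x"
  using assms by (intro dir_deriv_eqI has_derivative_diff) (simp_all add: frechet_derivative_works)

lemma dir_deriv_mult:
  assumes "f differentiable (at x)" "g differentiable (at x)"
  shows "dir_deriv v (\<lambda>x. f x * g x) x = f x * dir_deriv v g x + dir_deriv v f x * g x"
  using assms by (intro dir_deriv_eqI has_derivative_mult) (simp_all add: frechet_derivative_works)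

lemma dir_deriv_inverse:
  assumes "f differentiable (at x)" "f x \<noteq> 0"
  shows "dir_deriv v (\<lambda>x. inverse (f x)) x = - (inverse (f x) * dir_deriv v f x * inverse (f x))"
  using assms by (intro dir_deriv_eqI Deriv.has_derivative_inverse) (simp_all add: frechet_derivative_works)

lemma dir_deriv_linear:
  assumes "bounded_linear f"
  shows "dir_deriv v f x = f v"
  using assms by (intro dir_deriv_eqI bounded_linear_imp_has_derivative)

text \<open>A derivative sees only the germ of a function. When one of the two functions is not
  differentiable, neither is the other, and their Frechet derivatives are the same arbitrary choice.\<close>

lemma dir_deriv_cong:
  assumes "open \<Omega>" "x \<in> \<Omega>" "\<And>x. x \<in> \<Omega> \<Longrightarrow> f x = g x"
  shows "dir_deriv v f x = dir_deriv v g x"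
proof -
  have "frechet_derivative f (at x) = frechet_derivative g (at x)"
  proof (cases "f differentiable (at x)")
    case True
    then show ?thesis using frechet_derivative_transform_within_open assms by metis
  next
    case False
    then have "\<And>D. (f has_derivative D) (at x) \<longleftrightarrow> (g has_derivative D) (at x)"
      using assms by (metis has_derivative_transform_within_open)
    then show ?thesis by (simp add: frechet_derivative_def)
  qed
  then show ?thesis by simp
qed

section \<open>Closure properties of smooth functions\<close>

text \<open>The derivative of a product, say, equals the expression given by the product rule only at
  points where the factors are differentiable, hence only on the open set in question. The
  inductive closure proofs below replace one by the other through this congruence.\<close>

lemma Ck_on_cong:
  assumes "open \<Omega>" "\<And>x. x \<in> \<Omega> \<Longrightarrow> f x = g x"
  shows "Ck_on k \<Omega> f \<longleftrightarrow> Ck_on k \<Omega> g"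
  using assms(2)
proof (induction k arbitrary: f g)
  case 0
  then show ?case by (simp cong: continuous_on_cong)
next
  case (Suc k)
  have "f differentiable (at x) \<longleftrightarrow> g differentiable (at x)" if "x \<in> \<Omega>" for x
    unfolding differentiable_def
    using has_derivative_transform_within_open[OF _ assms(1) that] Suc.prems by metis
  moreover have "Ck_on k \<Omega> (dir_deriv v f) \<longleftrightarrow> Ck_on k \<Omega> (dir_deriv v g)" for v
    by (rule Suc.IH) (rule dir_deriv_cong[OF assms(1) _ Suc.prems])
  ultimately show ?case by simp
qed

text \<open>In the product rule the factors themselves occur next to their derivatives, so the induction
  step for products needs a function of class \<open>C\<^sup>k\<^sup>+\<^sup>1\<close> to be of class \<open>C\<^sup>k\<close>.\<close>

lemma Ck_on_SucD: "Ck_on (Suc k) \<Omega> f \<Longrightarrow> Ck_on k \<Omega> f"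
proof (induction k arbitrary: f)
  case 0
  then show ?case
    by (auto intro!: continuous_at_imp_continuous_on differentiable_imp_continuous_within)
next
  case (Suc k)
  then show ?case by (metis Ck_on.simps(2))
qed

lemma Ck_on_const: "Ck_on k \<Omega> (\<lambda>x. c)"
  by (induction k arbitrary: c) simp_all

lemma Ck_on_linear:
  assumes "bounded_linear f"
  shows "Ck_on k \<Omega> f"
proof (cases k)
  case 0
  then show ?thesis using assms by (simp add: linear_continuous_on)
next
  case (Suc k)
  then show ?thesis using assms
    by (simp add: dir_deriv_linear Ck_on_const bounded_linear_imp_differentiable)
qed

lemma Ck_on_add:
  assumes "open \<Omega>" "Ck_on k \<Omega> f" "Ck_on k \<Omega> g"
  shows "Ck_on k \<Omega> (\<lambda>x. f x + g x)"
  using assms(2,3)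
proof (induction k arbitrary: f g)
  case 0
  then show ?case by (simp add: continuous_on_add)
next
  case (Suc k)
  have "Ck_on k \<Omega> (dir_deriv v (\<lambda>x. f x + g x))" for v
    using Suc by (subst Ck_on_cong[OF assms(1) dir_deriv_add]) auto
  then show ?case using Suc.prems by simp
qed

lemma Ck_on_mult:
  assumes "open \<Omega>" "Ck_on k \<Omega> f" "Ck_on k \<Omega> g"
  shows "Ck_on k \<Omega> (\<lambda>x. f x * g x)"
  using assms(2,3)
proof (induction k arbitrary: f g)
  case 0
  then show ?case by (simp add: continuous_on_mult)
next
  case (Suc k)
  have "Ck_on k \<Omega> (dir_deriv v (\<lambda>x. f x * g x))" for v
    using Suc.IH Suc.prems Ck_on_SucD[OF Suc.prems(1)] Ck_on_SucD[OF Suc.prems(2)] assms(1)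
    by (subst Ck_on_cong[OF assms(1) dir_deriv_mult]) (auto intro!: Ck_on_add)
  then show ?case using Suc.prems by simp
qed

lemma Ck_on_inverse:
  assumes "open \<Omega>" "Ck_on k \<Omega> f" "\<And>x. x \<in> \<Omega> \<Longrightarrow> f x \<noteq> 0"
  shows "Ck_on k \<Omega> (\<lambda>x. inverse (f x))"
  using assms(2)
proof (induction k)
  case 0
  then show ?case using assms(3) by (simp add: continuous_on_inverse)
next
  case (Suc k)
  have inv: "Ck_on k \<Omega> (\<lambda>x. inverse (f x))" using Suc Ck_on_SucD by blast
  have "Ck_on k \<Omega> (dir_deriv v (\<lambda>x. inverse (f x)))" for v
  proof -
    have "dir_deriv v (\<lambda>x. inverse (f x)) x = (- 1) * (inverse (f x) * dir_deriv v f x * inverse (f x))"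
      if "x \<in> \<Omega>" for x
      using dir_deriv_inverse[of f x v] that Suc.prems assms(3) by simp
    moreover have "Ck_on k \<Omega> (\<lambda>x. (- 1) * (inverse (f x) * dir_deriv v f x * inverse (f x)))"
      using inv Suc.prems by (intro Ck_on_mult Ck_on_const assms(1)) simp_all
    ultimately show ?thesis
      by (subst Ck_on_cong[OF assms(1)]) (assumption | rule refl)+
  qed
  then show ?case using Suc.prems assms(3) by simp
qed

lemma smooth_on_cong:
  "open \<Omega> \<Longrightarrow> (\<And>x. x \<in> \<Omega> \<Longrightarrow> f x = g x) \<Longrightarrow> smooth_on \<Omega> f \<longleftrightarrow> smooth_on \<Omega> g"
  unfolding smooth_on_def by (simp cong: Ck_on_cong)

lemma smooth_on_const: "smooth_on \<Omega> (\<lambda>x. c)"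
  by (simp add: smooth_on_def Ck_on_const)

lemma smooth_on_linear: "bounded_linear f \<Longrightarrow> smooth_on \<Omega> f"
  by (simp add: smooth_on_def Ck_on_linear)

lemma smooth_on_add:
  "open \<Omega> \<Longrightarrow> smooth_on \<Omega> f \<Longrightarrow> smooth_on \<Omega> g \<Longrightarrow> smooth_on \<Omega> (\<lambda>x. f x + g x)"
  by (simp add: smooth_on_def Ck_on_add)

lemma smooth_on_mult:
  "open \<Omega> \<Longrightarrow> smooth_on \<Omega> f \<Longrightarrow> smooth_on \<Omega> g \<Longrightarrow> smooth_on \<Omega> (\<lambda>x. f x * g x)"
  by (simp add: smooth_on_def Ck_on_mult)

lemma smooth_on_diff:
  assumes "open \<Omega>" "smooth_on \<Omega> f" "smooth_on \<Omega> g"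
  shows "smooth_on \<Omega> (\<lambda>x. f x - g x)"
  using smooth_on_add[OF assms(1,2) smooth_on_mult[OF assms(1) smooth_on_const[of _ "- 1"] assms(3)]]
  by simp

lemma smooth_on_power:
  "open \<Omega> \<Longrightarrow> smooth_on \<Omega> f \<Longrightarrow> smooth_on \<Omega> (\<lambda>x. f x ^ n)"
  by (induction n) (simp_all add: smooth_on_const smooth_on_mult)

lemma smooth_on_inverse:
  "open \<Omega> \<Longrightarrow> smooth_on \<Omega> f \<Longrightarrow> (\<And>x. x \<in> \<Omega> \<Longrightarrow> f x \<noteq> 0) \<Longrightarrow> smooth_on \<Omega> (\<lambda>x. inverse (f x))"
  by (simp add: smooth_on_def Ck_on_inverse)

lemma smooth_on_dir_deriv: "smooth_on \<Omega> f \<Longrightarrow> smooth_on \<Omega> (dir_deriv v f)"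
  unfolding smooth_on_def by (metis Ck_on.simps(2))

lemma smooth_on_imp_differentiable: "smooth_on \<Omega> f \<Longrightarrow> x \<in> \<Omega> \<Longrightarrow> f differentiable (at x)"
  unfolding smooth_on_def by (metis Ck_on.simps(2))

lemma smooth_on_imp_continuous_on: "smooth_on \<Omega> f \<Longrightarrow> continuous_on \<Omega> f"
  unfolding smooth_on_def by (metis Ck_on.simps(1))

lemmas smooth_on_intros =
  smooth_on_const smooth_on_add smooth_on_diff smooth_on_mult smooth_on_power smooth_on_dir_deriv

section \<open>Symmetry of second derivatives\<close>

lemma mvt_along_line:
  fixes f :: "'a::real_normed_vector \<Rightarrow> real"
  assumes "0 < t" "\<And>s. s \<in> {0..t} \<Longrightarrow> f differentiable (at (x + s *\<^sub>R u))"
  obtains s where "s \<in> {0..t}" "f (x + t *\<^sub>R u) - f x = t * dir_deriv u f (x + s *\<^sub>R u)"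
proof -
  have "((\<lambda>s. f (x + s *\<^sub>R u)) has_real_derivative dir_deriv u f (x + s *\<^sub>R u)) (at s)"
    if "0 \<le> s" "s \<le> t" for s
  proof -
    let ?F = "frechet_derivative f (at (x + s *\<^sub>R u))"
    have F: "(f has_derivative ?F) (at (x + s *\<^sub>R u))"
      using assms(2) that by (simp flip: frechet_derivative_works)
    have "((\<lambda>s. f (x + s *\<^sub>R u)) has_derivative (\<lambda>r. ?F (r *\<^sub>R u))) (at s)"
      by (rule has_derivative_compose[where f="\<lambda>s. x + s *\<^sub>R u", OF _ F]) (auto intro!: derivative_eq_intros)
    then show ?thesis
      using linear_cmul[OF has_derivative_linear[OF F]]
      by (simp add: has_field_derivative_def mult_commute_abs)
  qed
  from MVT2[OF assms(1) this] obtain s where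
    "0 < s" "s < t" "f (x + t *\<^sub>R u) - f (x + 0 *\<^sub>R u) = (t - 0) * dir_deriv u f (x + s *\<^sub>R u)"
    by blast
  then show ?thesis using that[of s] by simp
qed

text \<open>Two applications of the mean value theorem: along \<open>u\<close> for the increment of \<open>f\<close> in the
  direction \<open>v\<close>, then along \<open>v\<close> for the derivative that appears. The left-hand side is symmetric in
  \<open>u\<close> and \<open>v\<close>, which is what makes the second derivatives commute.\<close>

lemma second_difference_eq:
  fixes f :: "'a::euclidean_space \<Rightarrow> real"
  assumes f: "smooth_on \<Omega> f" and t: "0 < t"
    and box: "\<And>a b. a \<in> {0..t} \<Longrightarrow> b \<in> {0..t} \<Longrightarrow> x + a *\<^sub>R u + b *\<^sub>R v \<in> \<Omega>"
  obtains a b where "a \<in> {0..t}" "b \<in> {0..t}"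
    "f (x + t *\<^sub>R u + t *\<^sub>R v) - f (x + t *\<^sub>R u) - f (x + t *\<^sub>R v) + f x
      = t * (t * dir_deriv v (dir_deriv u f) (x + a *\<^sub>R u + b *\<^sub>R v))"
proof -
  let ?g = "\<lambda>y. f (t *\<^sub>R v + y) - f y"
  have *: "f differentiable (at (x + s *\<^sub>R u))" "f differentiable (at (t *\<^sub>R v + (x + s *\<^sub>R u)))"
    if "s \<in> {0..t}" for s
    using box[OF that, of 0] box[OF that, of t] t smooth_on_imp_differentiable[OF f]
    by (simp_all add: algebra_simps)
  have sh: "((\<lambda>y. f (t *\<^sub>R v + y)) has_derivative frechet_derivative f (at (t *\<^sub>R v + (x + s *\<^sub>R u))))
      (at (x + s *\<^sub>R u))"
    if "s \<in> {0..t}" for s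
    by (rule has_derivative_compose[where f="\<lambda>y. t *\<^sub>R v + y" and f'="\<lambda>y. y"])
       (use *(2)[OF that] in \<open>auto intro!: derivative_eq_intros simp flip: frechet_derivative_works\<close>)
  have g: "(?g has_derivative (\<lambda>h. frechet_derivative f (at (t *\<^sub>R v + (x + s *\<^sub>R u))) h
      - frechet_derivative f (at (x + s *\<^sub>R u)) h)) (at (x + s *\<^sub>R u))"
    if "s \<in> {0..t}" for s
    using sh[OF that] *(1)[OF that] by (intro has_derivative_diff) (simp_all only: frechet_derivative_works)
  obtain a where a: "a \<in> {0..t}"
    and ga: "?g (x + t *\<^sub>R u) - ?g x = t * dir_deriv u ?g (x + a *\<^sub>R u)"
    by (rule mvt_along_line[OF t, of ?g x u]) (use g in \<open>auto simp: differentiable_def\<close>)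
  have "dir_deriv u f differentiable (at (x + a *\<^sub>R u + s *\<^sub>R v))" if "s \<in> {0..t}" for s
    using smooth_on_imp_differentiable[OF smooth_on_dir_deriv[OF f]] box[OF a that] .
  then obtain b where b: "b \<in> {0..t}"
    and "dir_deriv u f (x + a *\<^sub>R u + t *\<^sub>R v) - dir_deriv u f (x + a *\<^sub>R u)
      = t * dir_deriv v (dir_deriv u f) (x + a *\<^sub>R u + b *\<^sub>R v)"
    using mvt_along_line[OF t, of "dir_deriv u f" "x + a *\<^sub>R u" v] by blast
  with ga dir_deriv_eqI[OF g[OF a], of u] show ?thesis
    by (intro that[OF a b]) (simp add: algebra_simps)
qed

text \<open>The intermediate point of the previous lemma tends to \<open>x\<close>, where the second derivative is
  continuous.\<close>

lemma second_difference_quotient_tendsto: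
  fixes f :: "'a::euclidean_space \<Rightarrow> real"
  assumes "open \<Omega>" and f: "smooth_on \<Omega> f" and x: "x \<in> \<Omega>"
  shows "((\<lambda>t. (f (x + t *\<^sub>R u + t *\<^sub>R v) - f (x + t *\<^sub>R u) - f (x + t *\<^sub>R v) + f x) / t^2)
    \<longlongrightarrow> dir_deriv v (dir_deriv u f) x) (at_right 0)"
    (is "(?q \<longlongrightarrow> ?G x) _")
proof (rule tendstoI)
  fix e :: real assume "e > 0"
  have "continuous_on \<Omega> ?G"
    by (intro smooth_on_imp_continuous_on smooth_on_dir_deriv f)
  then have "?G \<midarrow>x\<rightarrow> ?G x"
    using assms(1) x by (simp add: continuous_on_eq_continuous_at isCont_def)
  from tendstoD[OF tendsto_at_iff_tendsto_nhds[THEN iffD1, OF this] \<open>e > 0\<close>]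
  have "\<forall>\<^sub>F y in nhds x. dist (?G y) (?G x) < e" .
  moreover have "\<forall>\<^sub>F y in nhds x. y \<in> \<Omega>"
    using assms(1) x by (rule eventually_nhds_in_open)
  ultimately have "\<forall>\<^sub>F y in nhds x. dist (?G y) (?G x) < e \<and> y \<in> \<Omega>"
    by (rule eventually_conj)
  then obtain d where d: "d > 0" "\<And>y. dist y x < d \<Longrightarrow> dist (?G y) (?G x) < e \<and> y \<in> \<Omega>"
    unfolding eventually_nhds_metric by blast
  \<comment> \<open>Parallelograms with sides shorter than \<open>r\<close> times \<open>u\<close> and \<open>v\<close> stay in the ball of radius \<open>d\<close>;
    the summand \<open>1\<close> covers the case that both directions vanish.\<close>
  define r where "r = d / (norm u + norm v + 1)"
  have pos: "norm u + norm v + 1 > 0" by (simp add: add_nonneg_pos)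
  have r: "r > 0" "r * (norm u + norm v + 1) = d" using d(1) pos by (simp_all add: r_def)
  have near: "dist (x + a *\<^sub>R u + b *\<^sub>R v) x < d"
    if "a \<in> {0..t}" "b \<in> {0..t}" "t < r" for a b t
  proof -
    have "dist (x + a *\<^sub>R u + b *\<^sub>R v) x = norm (a *\<^sub>R u + b *\<^sub>R v)"
      by (simp add: dist_norm)
    also have "\<dots> \<le> \<bar>a\<bar> * norm u + \<bar>b\<bar> * norm v"
      by (metis norm_scaleR norm_triangle_ineq)
    also have "\<dots> \<le> r * norm u + r * norm v"
      using that by (intro add_mono mult_right_mono) auto
    also have "\<dots> < d" using r by (simp add: algebra_simps)
    finally show ?thesis .
  qed
  have "dist (?q t) (?G x) < e" if t: "0 < t" "t < r" for t
  proof -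
    have "x + a *\<^sub>R u + b *\<^sub>R v \<in> \<Omega>" if "a \<in> {0..t}" "b \<in> {0..t}" for a b
      using d(2) near that t(2) by blast
    from second_difference_eq[OF f t(1) this] obtain a b where ab: "a \<in> {0..t}" "b \<in> {0..t}"
      and eq: "f (x + t *\<^sub>R u + t *\<^sub>R v) - f (x + t *\<^sub>R u) - f (x + t *\<^sub>R v) + f x
        = t * (t * ?G (x + a *\<^sub>R u + b *\<^sub>R v))"
      by blast
    have "?q t = ?G (x + a *\<^sub>R u + b *\<^sub>R v)"
      unfolding eq using t(1) by (simp add: power2_eq_square)
    then show ?thesis using d(2) near[OF ab t(2)] by simp
  qed
  then show "\<forall>\<^sub>F t in at_right 0. dist (?q t) (?G x) < e"
    using r(1) unfolding eventually_at_right_field by blast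
qed

text \<open>Exchanging \<open>u\<close> and \<open>v\<close> does not change the second difference quotient, so both mixed
  derivatives are limits of the same function.\<close>

lemma dir_deriv_commute:
  fixes f :: "'a::euclidean_space \<Rightarrow> real"
  assumes "open \<Omega>" and f: "smooth_on \<Omega> f" and x: "x \<in> \<Omega>"
  shows "dir_deriv v (dir_deriv u f) x = dir_deriv u (dir_deriv v f) x"
proof (rule tendsto_unique[OF _ second_difference_quotient_tendsto[OF assms]])
  show "((\<lambda>t. (f (x + t *\<^sub>R u + t *\<^sub>R v) - f (x + t *\<^sub>R u) - f (x + t *\<^sub>R v) + f x) / t^2)
    \<longlongrightarrow> dir_deriv u (dir_deriv v f) x) (at_right 0)"
    using second_difference_quotient_tendsto[OF assms, of v u] by (simp add: algebra_simps)
qed simp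

section \<open>Brackets on three-dimensional space\<close>

abbreviation partial_deriv :: "3 \<Rightarrow> (real^3 \<Rightarrow> real) \<Rightarrow> real^3 \<Rightarrow> real" where
  "partial_deriv i \<equiv> dir_deriv (axis i 1)"

text \<open>This is \<open>w \<bullet> (\<nabla>f \<times> \<nabla>g)\<close> for a vector field \<open>w\<close>, given by its components. Any skew-symmetric
  biderivation on three-dimensional space has this form. Written in partial derivatives, it can be
  differentiated once more by the rules for sums and products.\<close>

definition cross_bracket :: "(3 \<Rightarrow> real^3 \<Rightarrow> real) \<Rightarrow> (real^3) bracket" where
  "cross_bracket w f g = (\<lambda>x.
     w 1 x * (partial_deriv 2 f x * partial_deriv 3 g x - partial_deriv 3 f x * partial_deriv 2 g x) +
     w 2 x * (partial_deriv 3 f x * partial_deriv 1 g x - partial_deriv 1 f x * partial_deriv 3 g x) +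
     w 3 x * (partial_deriv 1 f x * partial_deriv 2 g x - partial_deriv 2 f x * partial_deriv 1 g x))"

text \<open>The product rule for a trilinear expression, with the derivative moved inside by the symmetry
  of the Hessians.\<close>

lemma partial_deriv_cross_bracket:
  assumes "open \<Omega>" and w: "\<And>i. smooth_on \<Omega> (w i)" and f: "smooth_on \<Omega> f" and g: "smooth_on \<Omega> g"
    and x: "x \<in> \<Omega>"
  shows "partial_deriv i (cross_bracket w f g) x =
    cross_bracket (\<lambda>k. partial_deriv i (w k)) f g x
    + cross_bracket w (partial_deriv i f) g x + cross_bracket w f (partial_deriv i g) x"
proof -
  note s = smooth_on_imp_differentiable[OF w x]
    smooth_on_imp_differentiable[OF smooth_on_dir_deriv[OF f] x]
    smooth_on_imp_differentiable[OF smooth_on_dir_deriv[OF g] x]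
  have "partial_deriv j (partial_deriv i f) x = partial_deriv i (partial_deriv j f) x"
    "partial_deriv j (partial_deriv i g) x = partial_deriv i (partial_deriv j g) x" for j
    using dir_deriv_commute assms by blast+
  then show ?thesis
    unfolding cross_bracket_def
    by (simp add: s dir_deriv_add dir_deriv_diff dir_deriv_mult) (simp add: algebra_simps)
qed

text \<open>The hypothesis is \<open>w \<bullet> curl w = 0\<close>. It is the right condition because the cyclic sum is
  \<open>- (w \<bullet> curl w)\<close> times the determinant of the three gradients.\<close>

lemma cross_bracket_jacobi:
  assumes "open \<Omega>" and w: "\<And>i. smooth_on \<Omega> (w i)"
    and f: "smooth_on \<Omega> f" and g: "smooth_on \<Omega> g" and h: "smooth_on \<Omega> h" and x: "x \<in> \<Omega>"
    and curl: "w 1 x * (partial_deriv 2 (w 3) x - partial_deriv 3 (w 2) x)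
      + w 2 x * (partial_deriv 3 (w 1) x - partial_deriv 1 (w 3) x)
      + w 3 x * (partial_deriv 1 (w 2) x - partial_deriv 2 (w 1) x) = 0"
  shows "cross_bracket w f (cross_bracket w g h) x + cross_bracket w g (cross_bracket w h f) x
    + cross_bracket w h (cross_bracket w f g) x = 0"
proof -
  have sym: "partial_deriv 2 (partial_deriv 1 k) x = partial_deriv 1 (partial_deriv 2 k) x"
    "partial_deriv 3 (partial_deriv 1 k) x = partial_deriv 1 (partial_deriv 3 k) x"
    "partial_deriv 3 (partial_deriv 2 k) x = partial_deriv 2 (partial_deriv 3 k) x"
    if "smooth_on \<Omega> k" for k
    using dir_deriv_commute assms(1) that x by blast+
  define d where "d k i = partial_deriv i k x" for k i
  \<comment> \<open>With the Hessians symmetric, this is a polynomial identity in the values at \<open>x\<close> of \<open>w\<close> and of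
    the first and second partial derivatives.\<close>
  have "cross_bracket w f (cross_bracket w g h) x + cross_bracket w g (cross_bracket w h f) x
    + cross_bracket w h (cross_bracket w f g) x =
    - (w 1 x * (d (w 3) 2 - d (w 2) 3)
      + w 2 x * (d (w 1) 3 - d (w 3) 1)
      + w 3 x * (d (w 2) 1 - d (w 1) 2)) *
     (d f 1 * (d g 2 * d h 3 - d g 3 * d h 2) + d f 2 * (d g 3 * d h 1 - d g 1 * d h 3)
      + d f 3 * (d g 1 * d h 2 - d g 2 * d h 1))"
    unfolding cross_bracket_def[of w f "cross_bracket w g h"] cross_bracket_def[of w g "cross_bracket w h f"]
      cross_bracket_def[of w h "cross_bracket w f g"]
      partial_deriv_cross_bracket[OF assms(1) w g h x] partial_deriv_cross_bracket[OF assms(1) w h f x]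
      partial_deriv_cross_bracket[OF assms(1) w f g x]
    unfolding cross_bracket_def sym[OF f] sym[OF g] sym[OF h] d_def
    by algebra
  then show ?thesis using curl by (simp add: d_def)
qed

lemma poisson_cross_bracket:
  assumes "open \<Omega>" and w: "\<And>i. smooth_on \<Omega> (w i)"
    and curl: "\<And>x. x \<in> \<Omega> \<Longrightarrow> w 1 x * (partial_deriv 2 (w 3) x - partial_deriv 3 (w 2) x)
      + w 2 x * (partial_deriv 3 (w 1) x - partial_deriv 1 (w 3) x)
      + w 3 x * (partial_deriv 1 (w 2) x - partial_deriv 2 (w 1) x) = 0"
  shows "poisson_bracket_on \<Omega> (cross_bracket w)"
proof -
  have diff: "f differentiable (at x)" if "smooth_on \<Omega> f" "x \<in> \<Omega>" for f x
    using smooth_on_imp_differentiable that by blast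
  have smooth: "smooth_on \<Omega> (cross_bracket w f g)" if "smooth_on \<Omega> f" "smooth_on \<Omega> g" for f g
    unfolding cross_bracket_def by (intro smooth_on_intros assms that)
  have locality: "cross_bracket w f g x = cross_bracket w f' g' x"
    if "\<forall>x\<in>\<Omega>. f x = f' x" "\<forall>x\<in>\<Omega>. g x = g' x" "x \<in> \<Omega>" for f f' g g' x
  proof -
    have "partial_deriv i f x = partial_deriv i f' x" "partial_deriv i g x = partial_deriv i g' x" for i
      using that dir_deriv_cong[OF assms(1) that(3)] by blast+
    then show ?thesis by (simp add: cross_bracket_def)
  qed
  have skew: "cross_bracket w f g x = - cross_bracket w g f x" for f g x
    by (simp add: cross_bracket_def algebra_simps)
  have lin: "cross_bracket w (\<lambda>u. p * f u + q * g u) h x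
      = p * cross_bracket w f h x + q * cross_bracket w g h x"
    if "smooth_on \<Omega> f" "smooth_on \<Omega> g" "x \<in> \<Omega>" for f g h p q x
    using that unfolding cross_bracket_def
    by (simp add: dir_deriv_add dir_deriv_mult diff) (simp add: algebra_simps)
  have leibniz: "cross_bracket w (\<lambda>u. f u * g u) h x
      = f x * cross_bracket w g h x + g x * cross_bracket w f h x"
    if "smooth_on \<Omega> f" "smooth_on \<Omega> g" "x \<in> \<Omega>" for f g h x
    using that unfolding cross_bracket_def
    by (simp add: dir_deriv_mult diff) (simp add: algebra_simps)
  have jacobi: "cross_bracket w f (cross_bracket w g h) x + cross_bracket w g (cross_bracket w h f) x
    + cross_bracket w h (cross_bracket w f g) x = 0"
    if "smooth_on \<Omega> f" "smooth_on \<Omega> g" "smooth_on \<Omega> h" "x \<in> \<Omega>" for f g h x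
    using cross_bracket_jacobi[OF assms(1) w that curl[OF that(4)]] .
  show ?thesis
    unfolding poisson_bracket_on_def
    by (intro conjI allI impI ballI; rule smooth locality skew lin leibniz jacobi; (erule bspec)?; assumption)
qed

text \<open>Needed because the gradient agrees with the vector of partial derivatives only where
  the function is differentiable. In the Jacobi identity the inner brackets coincide only on the
  open set, and the locality axiom of \<open>B'\<close> lets them be exchanged inside the outer bracket.\<close>

lemma poisson_bracket_on_cong:
  assumes "open \<Omega>" and B': "poisson_bracket_on \<Omega> B'"
    and eq: "\<And>f g x. smooth_on \<Omega> f \<Longrightarrow> smooth_on \<Omega> g \<Longrightarrow> x \<in> \<Omega> \<Longrightarrow> B f g x = B' f g x"
  shows "poisson_bracket_on \<Omega> B"
proof -
  note ax = B'[unfolded poisson_bracket_on_def]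
  note smooth' = ax[THEN conjunct1, rule_format]
    and local' = ax[THEN conjunct2, THEN conjunct1, rule_format]
    and skew' = ax[THEN conjunct2, THEN conjunct2, THEN conjunct1, rule_format]
    and lin' = ax[THEN conjunct2, THEN conjunct2, THEN conjunct2, THEN conjunct1, rule_format]
    and leibniz' = ax[THEN conjunct2, THEN conjunct2, THEN conjunct2, THEN conjunct2,
      THEN conjunct1, rule_format]
    and jacobi' = ax[THEN conjunct2, THEN conjunct2, THEN conjunct2, THEN conjunct2,
      THEN conjunct2, rule_format]
  have smooth: "smooth_on \<Omega> (B f g)" if "smooth_on \<Omega> f" "smooth_on \<Omega> g" for f g
    by (subst smooth_on_cong[OF assms(1) eq[OF that]]) (auto intro: smooth'[OF that])
  have nest: "B f (B g h) x = B' f (B' g h) x"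
    if "smooth_on \<Omega> f" "smooth_on \<Omega> g" "smooth_on \<Omega> h" "x \<in> \<Omega>" for f g h x
    using that by (simp add: eq smooth local'[OF _ _ _ smooth' _ eq])
  show ?thesis
    unfolding poisson_bracket_on_def
  proof (intro conjI allI impI ballI)
    show "B f g x = B f' g' x"
      if "smooth_on \<Omega> f" "smooth_on \<Omega> f'" "smooth_on \<Omega> g" "smooth_on \<Omega> g'"
        "\<forall>x\<in>\<Omega>. f x = f' x" "\<forall>x\<in>\<Omega>. g x = g' x" "x \<in> \<Omega>" for f f' g g' x
      using local'[of f f' g g' x] that by (simp add: eq)
    show "B f g x = - B g f x" if "smooth_on \<Omega> f" "smooth_on \<Omega> g" "x \<in> \<Omega>" for f g x
      unfolding eq[OF that] eq[OF that(2,1,3)] by (rule skew'[OF that])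
    show "B f (B g h) x + B g (B h f) x + B h (B f g) x = 0"
      if "smooth_on \<Omega> f" "smooth_on \<Omega> g" "smooth_on \<Omega> h" "x \<in> \<Omega>" for f g h x
      using jacobi'[OF that] that by (simp only: nest)
  qed (simp_all add: smooth eq lin' leibniz' smooth_on_add smooth_on_mult smooth_on_const assms(1))
qed

text \<open>The Riesz representative of the derivative is the adjoint of the derivative applied to \<open>1\<close>,
  and this is the unique candidate in the definition of the gradient.\<close>

lemma grad_nth:
  fixes f :: "real^'n \<Rightarrow> real"
  assumes "f differentiable (at x)"
  shows "grad f x $ i = dir_deriv (axis i 1) f x"
proof -
  have F: "(f has_derivative frechet_derivative f (at x)) (at x)"
    using assms by (simp add: frechet_derivative_works)
  have lin: "linear (frechet_derivative f (at x))" by (rule has_derivative_linear[OF F])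
  let ?D = "adjoint (frechet_derivative f (at x)) 1"
  have D: "GDERIV f x :> ?D"
    using F adjoint_works[OF lin] by (simp add: gderiv_def)
  have "grad f x = ?D"
    unfolding grad_def
  proof (rule the_equality)
    show "GDERIV f x :> ?D" by (rule D)
    fix D assume "GDERIV f x :> D"
    then have "(\<lambda>h. h \<bullet> D) = (\<lambda>h. h \<bullet> ?D)"
      using D unfolding gderiv_def by (rule has_derivative_unique)
    then show "D = ?D" by (metis vector_eq_ldot)
  qed
  then have "grad f x $ i = axis i 1 \<bullet> ?D" by (simp add: inner_axis')
  also have "\<dots> = dir_deriv (axis i 1) f x" using adjoint_works[OF lin] by simp
  finally show ?thesis .
qed

lemma scaled_bracket_eq_cross_bracket:
  assumes "C differentiable (at x)" "f differentiable (at x)" "g differentiable (at x)"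
  shows "scaled_bracket \<nu> (bracket_of C) f g x
    = cross_bracket (\<lambda>i x. \<nu> x * partial_deriv i C x) f g x"
  using assms
  by (simp add: scaled_bracket_def bracket_of_def cross_bracket_def grad_nth cross3_simps)

text \<open>For \<open>w = \<nu> \<nabla>C\<close> the Hessian of \<open>C\<close> drops out of the curl by symmetry, leaving
  \<open>curl w = \<nabla>\<nu> \<times> \<nabla>C\<close>, which is orthogonal to \<open>\<nabla>C\<close>.\<close>

lemma poisson_scaled_bracket:
  assumes "open \<Omega>" and C: "smooth_on \<Omega> C" and nu: "smooth_on \<Omega> \<nu>"
  shows "poisson_bracket_on \<Omega> (scaled_bracket \<nu> (bracket_of C))"
proof (rule poisson_bracket_on_cong[OF assms(1)])
  show "poisson_bracket_on \<Omega> (cross_bracket (\<lambda>i x. \<nu> x * partial_deriv i C x))"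
    (is "poisson_bracket_on _ (cross_bracket ?w)")
  proof (rule poisson_cross_bracket[OF assms(1)])
    show "smooth_on \<Omega> (?w i)" for i
      by (intro smooth_on_intros assms)
    fix x assume x: "x \<in> \<Omega>"
    have "partial_deriv i (?w j) x = \<nu> x * partial_deriv i (partial_deriv j C) x
      + partial_deriv i \<nu> x * partial_deriv j C x" for i j
      by (intro dir_deriv_mult smooth_on_imp_differentiable[OF _ x] nu smooth_on_dir_deriv C)
    moreover have "partial_deriv i (partial_deriv j C) x = partial_deriv j (partial_deriv i C) x" for i j
      using dir_deriv_commute assms(1) C x by blast
    ultimately show "?w 1 x * (partial_deriv 2 (?w 3) x - partial_deriv 3 (?w 2) x)
      + ?w 2 x * (partial_deriv 3 (?w 1) x - partial_deriv 1 (?w 3) x)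
      + ?w 3 x * (partial_deriv 1 (?w 2) x - partial_deriv 2 (?w 1) x) = 0"
      by (simp add: algebra_simps)
  qed
qed (use C in \<open>auto intro: scaled_bracket_eq_cross_bracket smooth_on_imp_differentiable\<close>)

section \<open>The rattleback system\<close>

lemma open_rattleback_domain: "open rattleback_domain"
  unfolding rattleback_domain_def by (intro open_Collect_neq continuous_intros)

lemma smooth_rattleback_function: "open \<Omega> \<Longrightarrow> smooth_on \<Omega> (rattleback_function l p q)"
  unfolding rattleback_function_def[abs_def]
  by (intro smooth_on_intros smooth_on_linear bounded_linear_vec_nth)

text \<open>As the inverse of a power with natural exponent, the factor falls under the closure properties
  of smooth functions.\<close>

lemma rattleback_factor_eq:
  assumes "l > 1"
  shows "rattleback_factor l u = inverse ((u $ 2) ^ (l - 1))"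
proof -
  have "1 - int l = - int (l - 1)" using assms by simp
  then show ?thesis by (simp only: rattleback_factor_def power_int_minus power_int_of_nat)
qed

lemma smooth_rattleback_factor:
  assumes "l > 1"
  shows "smooth_on rattleback_domain (rattleback_factor l)"
  unfolding rattleback_factor_eq[OF assms, abs_def]
  by (intro smooth_on_inverse smooth_on_power smooth_on_linear bounded_linear_vec_nth
      open_rattleback_domain) (simp add: rattleback_domain_def)

lemma partial_deriv_rattleback_function:
  shows "partial_deriv 1 (rattleback_function l p q) u = p * u $ 1 + q * (u $ 2) ^ l"
    and "partial_deriv 2 (rattleback_function l p q) u = p * u $ 2 + q * (u $ 1 * (real l * (u $ 2) ^ (l - 1)))"
    and "partial_deriv 3 (rattleback_function l p q) u = p * u $ 3"
proof -
  have "(rattleback_function l p q has_derivative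
    (\<lambda>h. p * (u $ 1 * h $ 1 + u $ 2 * h $ 2 + u $ 3 * h $ 3)
      + q * (h $ 1 * (u $ 2) ^ l + u $ 1 * (real l * h $ 2 * (u $ 2) ^ (l - 1))))) (at u)"
    unfolding rattleback_function_def[abs_def]
    by (auto intro!: derivative_eq_intros bounded_linear_imp_has_derivative bounded_linear_vec_nth
        simp: fun_eq_iff field_simps)
  from dir_deriv_eqI[OF this] show
    "partial_deriv 1 (rattleback_function l p q) u = p * u $ 1 + q * (u $ 2) ^ l"
    "partial_deriv 2 (rattleback_function l p q) u = p * u $ 2 + q * (u $ 1 * (real l * (u $ 2) ^ (l - 1)))"
    "partial_deriv 3 (rattleback_function l p q) u = p * u $ 3"
    by (simp_all add: axis_def)
qed

text \<open>Each component of the Hamiltonian field is a multiple of the determinant \<open>a d - b c\<close>; the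
  common factor \<open>y\<^sup>\<lambda>\<^sup>-\<^sup>1\<close>, called \<open>Y\<close> below, cancels against the rattleback factor.\<close>

lemma rattleback_field_hamiltonian:
  assumes "l > 1" and det: "a * d - b * c = 1" and u: "u \<in> rattleback_domain"
  shows "rattleback_field l u = hamiltonian_field
    (scaled_bracket (rattleback_factor l) (bracket_of (rattleback_function l a b)))
    (rattleback_function l c d) u"
proof -
  have diff: "rattleback_function l p q differentiable (at u)" for p q
    using smooth_on_imp_differentiable[OF smooth_rattleback_function[OF open_rattleback_domain] u] .
  have coord: "(\<lambda>u. u $ i) differentiable (at u)" for i
    by (intro bounded_linear_imp_differentiable bounded_linear_vec_nth)
  have pc: "partial_deriv j (\<lambda>u. u $ i) u = (if i = j then 1 else 0)" for i j
    by (simp add: dir_deriv_linear[OF bounded_linear_vec_nth] axis_def)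
  define Y where "Y = (u $ 2) ^ (l - 1)"
  define k where "k = inverse Y"
  have factor: "rattleback_factor l u = k"
    by (simp add: k_def Y_def rattleback_factor_eq[OF assms(1)])
  have k: "k * Y = 1"
    using u by (simp add: k_def Y_def rattleback_domain_def)
  have pow: "(u $ 2) ^ (l - Suc 0) = Y" "(u $ 2) ^ l = u $ 2 * Y"
    using assms(1) by (simp_all add: Y_def power_eq_if)
  show ?thesis
    unfolding hamiltonian_field_def bracket_matrix_def rattleback_field_def
    by (simp add: vec_eq_iff forall_3 matrix_vector_mult_def sum_3 grad_nth diff
        scaled_bracket_eq_cross_bracket coord cross_bracket_def pc partial_deriv_rattleback_function
        factor pow, intro conjI; use k det in algebra)
qed

theorem theorem2p2:
  fixes l :: nat and A :: "real^2^2"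
  assumes "l > 1" and "A \<in> SL2"
  defines "C \<equiv> rattleback_function l (A $ 1 $ 1) (A $ 1 $ 2)"
    and "H \<equiv> rattleback_function l (A $ 2 $ 1) (A $ 2 $ 2)"
    and "\<nu> \<equiv> rattleback_factor l"
  shows "smooth_on rattleback_domain C \<and>
    smooth_on rattleback_domain H \<and>
    smooth_on rattleback_domain \<nu> \<and>
    hamilton_poisson_realization rattleback_domain
      (scaled_bracket \<nu> (bracket_of C)) H (rattleback_field l)"
proof -
  have det: "A $ 1 $ 1 * A $ 2 $ 2 - A $ 1 $ 2 * A $ 2 $ 1 = 1"
    using assms(2) by (simp add: SL2_def det_2)
  note smooth = smooth_rattleback_function[OF open_rattleback_domain]
  show ?thesis
    unfolding hamilton_poisson_realization_def C_def H_def \<nu>_def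
    using rattleback_field_hamiltonian[OF assms(1) det]
    by (simp add: smooth smooth_rattleback_factor[OF assms(1)] open_rattleback_domain
        poisson_scaled_bracket)
qed

end
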